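(* (Pólya factorization.) If $Lx=0$ has a positive solution $x>0$ on an interval $[a,b)\subset(0,\infty)$ with $b\le\infty$, then for any function $y\in\mathbb D$ we have, on $[a,b)$, the factorization $$Ly=\rho_1D^{\alpha}\left\{\rho_2D^{\alpha}[\rho_1y]\right\},\qquad \rho_1(t):=\frac{e_0(t,a)}{x(t)}>0,\qquad \rho_2(t):=\frac{p(t)x^2(t)}{e_0^2(t,a)}>0.$$
   Context: $\mathcal I\subseteq\mathbb R$ is an interval containing $[a,b)$. The functions $\kappa_0,\kappa_1:[0,1]\times\mathcal I\to[0,\infty)$ are continuous and satisfy, for all $t\in\mathcal I$: $\lim_{\alpha\to0^+}\kappa_1(\alpha,t)=1$, $\lim_{\alpha\to0^+}\kappa_0(\alpha,t)=0$, $\lim_{\alpha\to1^-}\kappa_1(\alpha,t)=0$, $\lim_{\alpha\to1^-}\kappa_0(\alpha,t)=1$, $\kappa_1(\alpha,t)\ne0$ for $\alpha\in[0,1)$, and $\kappa_0(\alpha,t)\neq0$ for $\alpha\in(0,1]$. Fix $\alpha\in(0,1]$ and write $\kappa_j(t)=\kappa_j(\alpha,t)$. The conformable (proportional) derivative is $D^{\alpha}f(t)=\kappa_1(t)f(t)+\kappa_0(t)f'(t)$. For $t,s\in\mathcal I$, $e_0(t,s)=\exp\left(-\int_s^t\frac{\kappa_1(\tau)}{\kappa_0(\tau)}\,d\tau\right)$; $e_0^2(t,s)=(e_0(t,s))^2$. Let $p,q$ be continuous on $\mathcal I$ with $p(t)>0$ for all $t\in\mathcal I$, and set $Lx=D^{\alpha}[pD^{\alpha}x]+qx$.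 $\mathbb D$ is the set of all continuous functions $x$ such that $D^{\alpha}x$ and $D^{\alpha}[pD^{\alpha}x]$ exist and are continuous on $\mathcal I$; a solution of $Lx=0$ on an interval is a function with this regularity there and $Lx=0$ at every point of that interval. *)

theory Defs
  imports "HOL-Analysis.Analysis"
begin

definition conformable_kernels ::
  "real set \<Rightarrow> (real \<Rightarrow> real \<Rightarrow> real) \<Rightarrow> (real \<Rightarrow> real \<Rightarrow> real) \<Rightarrow> bool" where
  "conformable_kernels I \<kappa>\<^sub>0 \<kappa>\<^sub>1 \<longleftrightarrow>
     continuous_on ({0..1} \<times> I) (\<lambda>(\<alpha>, t). \<kappa>\<^sub>0 \<alpha> t) \<and>
     continuous_on ({0..1} \<times> I) (\<lambda>(\<alpha>, t). \<kappa>\<^sub>1 \<alpha> t) \<and>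
     (\<forall>\<alpha>\<in>{0..1}. \<forall>t\<in>I. 0 \<le> \<kappa>\<^sub>0 \<alpha> t \<and> 0 \<le> \<kappa>\<^sub>1 \<alpha> t) \<and>
     (\<forall>t\<in>I. ((\<lambda>\<alpha>. \<kappa>\<^sub>1 \<alpha> t) \<longlongrightarrow> 1) (at_right 0) \<and>
            ((\<lambda>\<alpha>. \<kappa>\<^sub>0 \<alpha> t) \<longlongrightarrow> 0) (at_right 0) \<and>
            ((\<lambda>\<alpha>. \<kappa>\<^sub>1 \<alpha> t) \<longlongrightarrow> 0) (at_left 1) \<and>
            ((\<lambda>\<alpha>. \<kappa>\<^sub>0 \<alpha> t) \<longlongrightarrow> 1) (at_left 1) \<and>
            (\<forall>\<alpha>\<in>{0..<1}. \<kappa>\<^sub>1 \<alpha> t \<noteq> 0) \<and>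
            (\<forall>\<alpha>\<in>{0<..1}. \<kappa>\<^sub>0 \<alpha> t \<noteq> 0))"

text \<open>In the definitions below \<open>k0\<close> and \<open>k1\<close> are the kernels at a fixed order \<open>\<alpha>\<close>, as
  functions of \<open>t\<close>. Derivatives are taken within the interval \<open>S\<close> on which the function is
  considered, hence one-sided at an endpoint belonging to \<open>S\<close>. As \<open>vector_derivative\<close> is total,
  existence of a conformable derivative is always stated separately, as differentiability within
  \<open>S\<close>; for \<open>k0 t \<noteq> 0\<close> the two amount to the same.\<close>

definition conf_deriv ::
  "(real \<Rightarrow> real) \<Rightarrow> (real \<Rightarrow> real) \<Rightarrow> real set \<Rightarrow> (real \<Rightarrow> real) \<Rightarrow> real \<Rightarrow> real" where
  "conf_deriv k0 k1 S f t = k1 t * f t + k0 t * vector_derivative f (at t within S)"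

definition conf_e0 ::
  "(real \<Rightarrow> real) \<Rightarrow> (real \<Rightarrow> real) \<Rightarrow> real \<Rightarrow> real \<Rightarrow> real" where
  "conf_e0 k0 k1 t s = exp (- (LBINT \<tau>=s..t. k1 \<tau> / k0 \<tau>))"

definition conf_L ::
  "(real \<Rightarrow> real) \<Rightarrow> (real \<Rightarrow> real) \<Rightarrow> (real \<Rightarrow> real) \<Rightarrow> (real \<Rightarrow> real) \<Rightarrow> real set
    \<Rightarrow> (real \<Rightarrow> real) \<Rightarrow> real \<Rightarrow> real" where
  "conf_L k0 k1 p q S x t =
     conf_deriv k0 k1 S (\<lambda>s. p s * conf_deriv k0 k1 S x s) t + q t * x t"

definition conf_domain ::
  "(real \<Rightarrow> real) \<Rightarrow> (real \<Rightarrow> real) \<Rightarrow> (real \<Rightarrow> real) \<Rightarrow> real set \<Rightarrow> (real \<Rightarrow> real) set" where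
  "conf_domain k0 k1 p S =
     {x. continuous_on S x \<and>
         x differentiable_on S \<and>
         continuous_on S (conf_deriv k0 k1 S x) \<and>
         (\<lambda>s. p s * conf_deriv k0 k1 S x s) differentiable_on S \<and>
         continuous_on S (conf_deriv k0 k1 S (\<lambda>s. p s * conf_deriv k0 k1 S x s))}"

definition conf_solution ::
  "(real \<Rightarrow> real) \<Rightarrow> (real \<Rightarrow> real) \<Rightarrow> (real \<Rightarrow> real) \<Rightarrow> (real \<Rightarrow> real) \<Rightarrow> real set
    \<Rightarrow> (real \<Rightarrow> real) \<Rightarrow> bool" where
  "conf_solution k0 k1 p q S x \<longleftrightarrow>
     x \<in> conf_domain k0 k1 p S \<and> (\<forall>t\<in>S. conf_L k0 k1 p q S x t = 0)"

end

theory Submission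
  imports Defs
begin

text \<open>Write \<open>D\<close> for the conformable derivative and \<open>E = e\<^sub>0(\<cdot>, a)\<close>. Since \<open>E' = - (\<kappa>\<^sub>1/\<kappa>\<^sub>0) E\<close>, we
  have \<open>D[E f] = E \<kappa>\<^sub>0 f'\<close>, so \<open>\<rho>\<^sub>2 D[\<rho>\<^sub>1 y] = W/E\<close> with the Wronskian-type expression
  \<open>W = x (p D y) - y (p D x)\<close>. The cross terms of \<open>D[W/E]\<close> cancel and leave
  \<open>(x D[p D y] - y D[p D x])/E\<close>; multiplying by \<open>\<rho>\<^sub>1 = E/x\<close> and using \<open>D[p D x] = - q x\<close>
  gives \<open>L y\<close>.\<close>

lemma conf_deriv_eq:
  assumes "(f has_real_derivative f') (at t within S)" "at t within S \<noteq> bot"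
  shows "conf_deriv k0 k1 S f t = k1 t * f t + k0 t * f'"
  using assms by (simp add: conf_deriv_def vector_derivative_within
      has_real_derivative_iff_has_vector_derivative)

text \<open>Solving \<open>D f = k1 f + k0 f'\<close> for \<open>f'\<close>, which needs
  \<open>k0 t \<noteq> 0\<close>. In this form the ordinary product and quotient rules yield results
  expressed through \<open>D\<close>.\<close>

lemma has_real_derivative_conf_deriv:
  assumes "f differentiable_on S" "t \<in> S" "at t within S \<noteq> bot" "k0 t \<noteq> 0"
  shows "(f has_real_derivative (conf_deriv k0 k1 S f t - k1 t * f t) / k0 t) (at t within S)"
proof -
  obtain f' where f': "(f has_real_derivative f') (at t within S)"
    using assms(1,2) by (auto simp: differentiable_on_def real_differentiable_def)
  show ?thesis
    using f' conf_deriv_eq[OF f' assms(3), of k0 k1] assms(4) by simp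
qed

text \<open>The fundamental theorem of calculus and the chain rule for \<open>exp\<close>. The
  compact interval is what the integral theorem requires; it also covers the one-sided derivative at
  \<open>a\<close>.\<close>

lemma has_real_derivative_conf_e0:
  assumes "continuous_on {a..d} (\<lambda>t. k1 t / k0 t)" "t \<in> {a..d}"
  shows "((\<lambda>t. conf_e0 k0 k1 t a) has_real_derivative - (k1 t / k0 t) * conf_e0 k0 k1 t a)
           (at t within {a..d})"
proof -
  have "((\<lambda>u. LBINT \<tau>=a..u. k1 \<tau> / k0 \<tau>) has_real_derivative k1 t / k0 t) (at t within {a..d})"
    unfolding has_real_derivative_iff_has_vector_derivative
    using assms by (intro interval_integral_FTC2) auto
  then show ?thesis
    unfolding conf_e0_def by (auto intro!: derivative_eq_intros)
qed

text \<open>Only the differential equation of \<open>E\<close> matters: it gives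
  \<open>D[E f] = E k0 f'\<close> with \<open>f = y/x\<close>. In the numerator
  \<open>x k0 y' - y k0 x'\<close> of the quotient rule, replacing \<open>k0 y'\<close> by
  \<open>D y - k1 y\<close> and \<open>k0 x'\<close> by \<open>D x - k1 x\<close> produces two terms
  \<open>k1 x y\<close> that cancel.\<close>

lemma conf_deriv_divide_exp_kernel:
  assumes nb: "at t within S \<noteq> bot" and t: "t \<in> S"
    and k0: "k0 t \<noteq> 0" and x: "x t \<noteq> 0"
    and E: "(E has_real_derivative - (k1 t / k0 t) * E t) (at t within S)"
    and xd: "x differentiable_on S" and yd: "y differentiable_on S"
  shows "(\<lambda>s. E s / x s * y s) differentiable (at t within S)"
    and "conf_deriv k0 k1 S (\<lambda>s. E s / x s * y s) t =
      E t * (x t * conf_deriv k0 k1 S y t - y t * conf_deriv k0 k1 S x t) / (x t)\<^sup>2"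
proof -
  note x' = has_real_derivative_conf_deriv[OF xd t nb, of k0 k1, OF k0]
  note y' = has_real_derivative_conf_deriv[OF yd t nb, of k0 k1, OF k0]
  note d = DERIV_mult[OF DERIV_divide[OF E x' x] y']
  show "(\<lambda>s. E s / x s * y s) differentiable (at t within S)"
    using d real_differentiable_def by blast
  show "conf_deriv k0 k1 S (\<lambda>s. E s / x s * y s) t =
      E t * (x t * conf_deriv k0 k1 S y t - y t * conf_deriv k0 k1 S x t) / (x t)\<^sup>2"
    unfolding conf_deriv_eq[OF d nb] using k0 x
    by (simp add: divide_simps) (simp add: algebra_simps power2_eq_square)
qed

text \<open>Let \<open>W\<close> be the numerator. Since both products carry the same
  \<open>p\<close>, the terms \<open>p (D x) (D y)\<close> cancel and
  \<open>k0 W' = x D ?u - y D ?v - 2 k1 W\<close>. The definition of \<open>D\<close> returns one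
  \<open>k1 W\<close>, and the derivative of \<open>1/E\<close>, which is \<open>(k1/k0)/E\<close>,
  returns the other.\<close>

lemma conf_deriv_wronskian:
  assumes nb: "at t within S \<noteq> bot" and t: "t \<in> S"
    and k0: "k0 t \<noteq> 0" and E0: "E t \<noteq> 0"
    and E: "(E has_real_derivative - (k1 t / k0 t) * E t) (at t within S)"
    and xd: "x differentiable_on S" and yd: "y differentiable_on S"
    and ud: "(\<lambda>s. p s * conf_deriv k0 k1 S y s) differentiable_on S" (is "?u differentiable_on S")
    and vd: "(\<lambda>s. p s * conf_deriv k0 k1 S x s) differentiable_on S" (is "?v differentiable_on S")
  shows "(\<lambda>s. (x s * ?u s - y s * ?v s) / E s) differentiable (at t within S)"
    and "conf_deriv k0 k1 S (\<lambda>s. (x s * ?u s - y s * ?v s) / E s) t =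
      (x t * conf_deriv k0 k1 S ?u t - y t * conf_deriv k0 k1 S ?v t) / E t"
proof -
  note x' = has_real_derivative_conf_deriv[OF xd t nb, of k0 k1, OF k0]
  note y' = has_real_derivative_conf_deriv[OF yd t nb, of k0 k1, OF k0]
  note u' = has_real_derivative_conf_deriv[OF ud t nb, of k0 k1, OF k0]
  note v' = has_real_derivative_conf_deriv[OF vd t nb, of k0 k1, OF k0]
  note d = DERIV_divide[OF DERIV_diff[OF DERIV_mult[OF x' u'] DERIV_mult[OF y' v']] E E0]
  show "(\<lambda>s. (x s * ?u s - y s * ?v s) / E s) differentiable (at t within S)"
    using d real_differentiable_def by blast
  show "conf_deriv k0 k1 S (\<lambda>s. (x s * ?u s - y s * ?v s) / E s) t =
      (x t * conf_deriv k0 k1 S ?u t - y t * conf_deriv k0 k1 S ?v t) / E t"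
    unfolding conf_deriv_eq[OF d nb] using k0 E0
    by (simp add: divide_simps) (simp add: algebra_simps)
qed

lemma conf_deriv_cong:
  assumes "\<And>s. s \<in> S \<Longrightarrow> f s = g s" "t \<in> S"
  shows "conf_deriv k0 k1 S f t = conf_deriv k0 k1 S g t"
proof -
  have "(f has_vector_derivative D) (at t within S) \<longleftrightarrow>
        (g has_vector_derivative D) (at t within S)" for D
    using assms by (metis has_vector_derivative_transform)
  then show ?thesis
    using assms by (simp add: conf_deriv_def vector_derivative_def)
qed

text \<open>Bridges \<open>y\<close>, given on all of \<open>I\<close>, and \<open>x\<close>, given
  only on \<open>J\<close>. A derivative within \<open>S\<close> is also one within
  \<open>T\<close>, and nontriviality of the smaller filter makes it the only one there.\<close>

lemma conf_deriv_subset: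
  assumes "f differentiable_on S" "T \<subseteq> S" "t \<in> T" "at t within T \<noteq> bot"
  shows "conf_deriv k0 k1 S f t = conf_deriv k0 k1 T f t"
proof -
  have "f differentiable (at t within S)"
    using assms by (auto simp: differentiable_on_def)
  then obtain f' where f': "(f has_real_derivative f') (at t within S)"
    by (auto simp: real_differentiable_def)
  have "at t within S \<noteq> bot"
    using assms(2,4) at_le by (metis bot.extremum_uniqueI)
  then show ?thesis
    using conf_deriv_eq f' DERIV_subset[OF f' assms(2)] assms(4) by metis
qed

theorem theorem10p1:
  fixes I J :: "real set" and a :: real and b :: ereal and \<alpha> :: real
    and \<kappa>\<^sub>0 \<kappa>\<^sub>1 :: "real \<Rightarrow> real \<Rightarrow> real"
    and p q x y \<rho>\<^sub>1 \<rho>\<^sub>2 :: "real \<Rightarrow> real"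
  assumes "is_interval I"
    and "0 < a" and "ereal a < b"
    and "J = {t. a \<le> t \<and> ereal t < b}"
    and "J \<subseteq> I"
    and "conformable_kernels I \<kappa>\<^sub>0 \<kappa>\<^sub>1"
    and "0 < \<alpha>" and "\<alpha> \<le> 1"
    and "continuous_on I p" and "continuous_on I q"
    and "\<forall>t\<in>I. 0 < p t"
    and "conf_solution (\<kappa>\<^sub>0 \<alpha>) (\<kappa>\<^sub>1 \<alpha>) p q J x"
    and "\<forall>t\<in>J. 0 < x t"
    and "y \<in> conf_domain (\<kappa>\<^sub>0 \<alpha>) (\<kappa>\<^sub>1 \<alpha>) p I"
    and "\<rho>\<^sub>1 = (\<lambda>t. conf_e0 (\<kappa>\<^sub>0 \<alpha>) (\<kappa>\<^sub>1 \<alpha>) t a / x t)"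
    and "\<rho>\<^sub>2 = (\<lambda>t. p t * (x t)\<^sup>2 / (conf_e0 (\<kappa>\<^sub>0 \<alpha>) (\<kappa>\<^sub>1 \<alpha>) t a)\<^sup>2)"
  shows "(\<forall>t\<in>J. 0 < \<rho>\<^sub>1 t \<and> 0 < \<rho>\<^sub>2 t) \<and>
    (\<lambda>s. \<rho>\<^sub>1 s * y s) differentiable_on J \<and>
    (\<lambda>s. \<rho>\<^sub>2 s * conf_deriv (\<kappa>\<^sub>0 \<alpha>) (\<kappa>\<^sub>1 \<alpha>) J (\<lambda>r. \<rho>\<^sub>1 r * y r) s) differentiable_on J \<and>
    (\<forall>t\<in>J. conf_L (\<kappa>\<^sub>0 \<alpha>) (\<kappa>\<^sub>1 \<alpha>) p q I y t =
       \<rho>\<^sub>1 t * conf_deriv (\<kappa>\<^sub>0 \<alpha>) (\<kappa>\<^sub>1 \<alpha>) J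
         (\<lambda>s. \<rho>\<^sub>2 s * conf_deriv (\<kappa>\<^sub>0 \<alpha>) (\<kappa>\<^sub>1 \<alpha>) J (\<lambda>r. \<rho>\<^sub>1 r * y r) s) t)"
proof -
  let ?k0 = "\<kappa>\<^sub>0 \<alpha>" and ?k1 = "\<kappa>\<^sub>1 \<alpha>"
  define E where "E = (\<lambda>t. conf_e0 ?k0 ?k1 t a)"
  note k = assms(6)[unfolded conformable_kernels_def]
  have Epos: "0 < E t" for t
    by (simp add: E_def conf_e0_def)
  have r1: "\<rho>\<^sub>1 = (\<lambda>t. E t / x t)" and r2: "\<rho>\<^sub>2 = (\<lambda>t. p t * (x t)\<^sup>2 / (E t)\<^sup>2)"
    using assms(15,16) by (simp_all add: E_def)
  have k0: "?k0 t \<noteq> 0" if "t \<in> J" for t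
    using k assms(5,7,8) that by (meson greaterThanAtMost_iff subsetD)
  have xpos: "0 < x t" "0 < p t" if "t \<in> J" for t
    using assms(5,11,13) that by auto
  \<comment> \<open>\<open>J\<close> is open at its right end, which may be infinite, so every point
    of it lies strictly left of the end of a compact interval inside \<open>J\<close>. Local
    statements can be proved there.\<close>
  have ex: "\<exists>d>t. {a..d} \<subseteq> J" if t: "t \<in> J" for t
  proof -
    obtain d where "ereal t < ereal d" "ereal d < b"
      using t assms(4) by (metis (no_types, lifting) ereal_dense2 mem_Collect_eq)
    then show ?thesis
      unfolding assms(4) by (intro exI[of _ d]) (auto intro: le_less_trans[of _ "ereal d"])
  qed
  \<comment> \<open>The two sets coincide on the open neighbourhood \<open>{..<d}\<close> of
    \<open>t\<close>.\<close>
  have at_eq: "at t within J = at t within {a..d}" if "t \<in> J" "t < d" "{a..d} \<subseteq> J" for t d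
    by (rule at_within_nhd[of _ "{..<d}"]) (use that assms(4) in auto)
  have nb: "at t within J \<noteq> bot" if t: "t \<in> J" for t
  proof -
    obtain d where d: "t < d" "{a..d} \<subseteq> J" using ex[OF t] by blast
    have "a \<le> t" using t assms(4) by auto
    then show ?thesis
      unfolding at_eq[OF t d] using d(1) by (simp add: trivial_limit_within islimpt_Icc)
  qed
  have kc: "continuous_on I (\<lambda>t. \<kappa> \<alpha> t)" if "continuous_on ({0..1} \<times> I) (\<lambda>(\<alpha>, t). \<kappa> \<alpha> t)"
    for \<kappa> :: "real \<Rightarrow> real \<Rightarrow> real"
  proof -
    have c: "continuous_on I (\<lambda>t. (\<alpha>, t))"
      by (rule continuous_on_Pair[OF continuous_on_const continuous_on_id])
    have "(\<lambda>t. (\<alpha>, t)) ` I \<subseteq> {0..1} \<times> I"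
      using assms(7,8) by auto
    from continuous_on_compose2[OF that c this] show ?thesis
      by simp
  qed
  have E': "(E has_real_derivative - (?k1 t / ?k0 t) * E t) (at t within J)" if t: "t \<in> J" for t
  proof -
    obtain d where d: "t < d" "{a..d} \<subseteq> J" using ex[OF t] by blast
    have "continuous_on {a..d} (\<lambda>t. ?k1 t / ?k0 t)"
      using continuous_on_subset[OF kc[of \<kappa>\<^sub>0]] continuous_on_subset[OF kc[of \<kappa>\<^sub>1]] k k0
        order_trans[OF d(2) assms(5)] d(2)
      by (intro continuous_on_divide) blast+
    then show ?thesis
      unfolding at_eq[OF t d] E_def using t d(1) assms(4)
      by (intro has_real_derivative_conf_e0) auto
  qed
  let ?u = "\<lambda>s. p s * conf_deriv ?k0 ?k1 J y s" and ?v = "\<lambda>s. p s * conf_deriv ?k0 ?k1 J x s"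
  let ?uI = "\<lambda>s. p s * conf_deriv ?k0 ?k1 I y s"
  have xd: "x differentiable_on J" and vd: "?v differentiable_on J"
    and Lx: "\<And>t. t \<in> J \<Longrightarrow> conf_deriv ?k0 ?k1 J ?v t = - q t * x t"
    using assms(12) by (auto simp: conf_solution_def conf_domain_def conf_L_def eq_neg_iff_add_eq_0)
  have yI: "y differentiable_on I" and uI: "?uI differentiable_on I"
    using assms(14) by (auto simp: conf_domain_def)
  have yd: "y differentiable_on J"
    using yI assms(5) by (rule differentiable_on_subset)
  \<comment> \<open>If \<open>a\<close> is interior to \<open>I\<close>, the derivative there is
    two-sided within \<open>I\<close> but one-sided within \<open>J\<close>; differentiability on
    \<open>I\<close> makes both agree.\<close>
  have u_eq: "?uI t = ?u t" if "t \<in> J" for t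
    using conf_deriv_subset[OF yI assms(5) that nb[OF that]] by simp
  have ud: "?u differentiable_on J"
    unfolding differentiable_on_def
  proof
    fix t assume t: "t \<in> J"
    have "?uI differentiable at t within J"
      using differentiable_on_subset[OF uI assms(5)] t by (auto simp: differentiable_on_def)
    then show "?u differentiable at t within J"
      by (rule differentiable_transform_within[OF _ zero_less_one t]) (simp add: u_eq)
  qed
  \<comment> \<open>\<open>L\<close> nests two derivatives: first the outer one is restricted to
    \<open>J\<close>, then the inner one is replaced, which is allowed because the outer one now
    sees values on \<open>J\<close> only.\<close>
  have Ly: "conf_L ?k0 ?k1 p q I y t = conf_deriv ?k0 ?k1 J ?u t + q t * y t" if t: "t \<in> J" for t
    unfolding conf_L_def conf_deriv_subset[OF uI assms(5) t nb[OF t]]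
    using conf_deriv_cong[of J ?uI ?u, OF u_eq t] by simp
  note R = conf_deriv_divide_exp_kernel[where ?k0.0 = ?k0 and ?k1.0 = ?k1 and E = E and x = x,
      OF nb _ k0 less_imp_neq[OF xpos(1), symmetric] E' xd yd]
  note W = conf_deriv_wronskian[where ?k0.0 = ?k0 and ?k1.0 = ?k1 and E = E,
      OF nb _ k0 less_imp_neq[OF Epos, symmetric] E' xd yd ud vd]
  \<comment> \<open>The weight \<open>p x^2 / E^2\<close> meets the factor \<open>E / x^2\<close>
    and leaves \<open>p / E\<close>.\<close>
  have inner: "\<rho>\<^sub>2 s * conf_deriv ?k0 ?k1 J (\<lambda>r. \<rho>\<^sub>1 r * y r) s = (x s * ?u s - y s * ?v s) / E s"
    if s: "s \<in> J" for s
    unfolding r1 r2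
      R(2)[OF s s s s s]
    using xpos[OF s] Epos[of s] by (simp add: divide_simps) (simp add: algebra_simps power2_eq_square)
  have "0 < \<rho>\<^sub>1 t \<and> 0 < \<rho>\<^sub>2 t" if "t \<in> J" for t
    using xpos[OF that] Epos[of t] by (simp add: r1 r2)
  moreover have "(\<lambda>s. \<rho>\<^sub>1 s * y s) differentiable_on J"
    unfolding differentiable_on_def r1
    using R(1) by blast
  moreover have "(\<lambda>s. \<rho>\<^sub>2 s * conf_deriv ?k0 ?k1 J (\<lambda>r. \<rho>\<^sub>1 r * y r) s) differentiable_on J"
    unfolding differentiable_on_def
  proof
    fix t assume t: "t \<in> J"
    show "(\<lambda>s. \<rho>\<^sub>2 s * conf_deriv ?k0 ?k1 J (\<lambda>r. \<rho>\<^sub>1 r * y r) s) differentiable at t within J"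
      by (rule differentiable_transform_within[OF W(1)[OF t t t t] zero_less_one t])
        (simp add: inner)
  qed
  moreover have "conf_L ?k0 ?k1 p q I y t =
      \<rho>\<^sub>1 t * conf_deriv ?k0 ?k1 J (\<lambda>s. \<rho>\<^sub>2 s * conf_deriv ?k0 ?k1 J (\<lambda>r. \<rho>\<^sub>1 r * y r) s) t"
    if t: "t \<in> J" for t
  proof -
    have "conf_deriv ?k0 ?k1 J (\<lambda>s. \<rho>\<^sub>2 s * conf_deriv ?k0 ?k1 J (\<lambda>r. \<rho>\<^sub>1 r * y r) s) t =
        conf_deriv ?k0 ?k1 J (\<lambda>s. (x s * ?u s - y s * ?v s) / E s) t"
      by (rule conf_deriv_cong[OF inner t])
    \<comment> \<open>The equation for \<open>x\<close> makes \<open>x t\<close> a common factor of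
      the numerator, so multiplying by \<open>E t / x t\<close> cancels completely.\<close>
    also have "\<dots> = (x t * conf_deriv ?k0 ?k1 J ?u t + y t * (q t * x t)) / E t"
      unfolding W(2)[OF t t t t] Lx[OF t] by simp
    finally show ?thesis
      unfolding Ly[OF t] using xpos[OF t] Epos[of t]
      by (simp add: fun_cong[OF r1, of t] field_simps)
  qed
  ultimately show ?thesis
    by blast
qed

end
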